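(* Let $X$ be a real vector space and let $\varphi_i\colon X\to(-\infty,\infty]$, $i=1,2$, be proper convex functions such that $$\mathrm{core}(\mathrm{epi}(\varphi_1))\cap\mathrm{core}(\mathrm{epi}(\varphi_2))\neq\emptyset.$$ Then $$\partial(\varphi_1+\varphi_2)(\bar{x})=\partial\varphi_1(\bar{x})+\partial\varphi_2(\bar{x})\quad\text{for all }\bar{x}\in\mathrm{dom}(\varphi_1)\cap\mathrm{dom}(\varphi_2).$$
   Context: All vector spaces are real and carry no topology. $X'$ denotes the algebraic dual of $X$ (all linear functions $X\to\mathbb{R}$). For a subset $\Omega$ of a vector space $Z$, $\mathrm{core}(\Omega):=\{x\in\Omega\mid \forall v\in Z\ \exists\delta>0\ \forall t\in\mathbb{R}\text{ with }|t|<\delta:\ x+tv\in\Omega\}$. For $\varphi\colon X\to(-\infty,\infty]$: $\mathrm{dom}(\varphi):=\{x\in X\mid\varphi(x)<\infty\}$; $\varphi$ is proper if $\mathrm{dom}(\varphi)\neq\emptyset$; $\mathrm{epi}(\varphi):=\{(x,\alpha)\in X\times\mathbb{R}\mid\alpha\ge\varphi(x)\}$ (its core is taken in $X\times\mathbb{R}$). For convex $\varphi$ and $\bar{x}\in\mathrm{dom}(\varphi)$, the subdifferential is $\partial\varphi(\bar{x}):=\{f\in X'\mid\varphi(x)\ge\varphi(\bar{x})+f(x-\bar{x})\ \forall x\in X\}$. The sum of sets in $X'$ is the Minkowski sum. *)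

theory Defs
  imports "HOL-Analysis.Analysis" "HOL-Library.Function_Algebras"
begin

definition algebraic_dual :: "('a::real_vector \<Rightarrow> real) set" where
  "algebraic_dual = {f. linear f}"

definition core :: "'z::real_vector set \<Rightarrow> 'z set" where
  "core \<Omega> = {x \<in> \<Omega>. \<forall>v. \<exists>\<delta>>0. \<forall>t::real. \<bar>t\<bar> < \<delta> \<longrightarrow> x + t *\<^sub>R v \<in> \<Omega>}"

(* A function into (-\<infinity>, \<infinity>] is an ereal-valued function together with the explicit
   condition that it never takes the value -\<infinity>. *)
definition never_minus_infinity :: "('a \<Rightarrow> ereal) \<Rightarrow> bool" where
  "never_minus_infinity \<phi> \<longleftrightarrow> (\<forall>x. \<phi> x \<noteq> -\<infinity>)"

definition eff_dom :: "('a \<Rightarrow> ereal) \<Rightarrow> 'a set" where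
  "eff_dom \<phi> = {x. \<phi> x < \<infinity>}"

definition proper :: "('a \<Rightarrow> ereal) \<Rightarrow> bool" where
  "proper \<phi> \<longleftrightarrow> eff_dom \<phi> \<noteq> {}"

definition epi :: "('a \<Rightarrow> ereal) \<Rightarrow> ('a \<times> real) set" where
  "epi \<phi> = {(x, \<alpha>). ereal \<alpha> \<ge> \<phi> x}"

(* The library's convex_on covers only real-valued functions. The weights are taken
   strictly between 0 and 1, so no product of 0 and \<infinity> occurs. *)
definition convex_fun :: "('a::real_vector \<Rightarrow> ereal) \<Rightarrow> bool" where
  "convex_fun \<phi> \<longleftrightarrow>
     (\<forall>x y. \<forall>t::real. 0 < t \<and> t < 1 \<longrightarrow>
        \<phi> (t *\<^sub>R x + (1 - t) *\<^sub>R y) \<le> ereal t * \<phi> x + ereal (1 - t) * \<phi> y)"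

(* Only meaningful for convex \<phi> and x0 in eff_dom \<phi>; no convention is attached to
   the values elsewhere. *)
definition subdifferential :: "('a::real_vector \<Rightarrow> ereal) \<Rightarrow> 'a \<Rightarrow> ('a \<Rightarrow> real) set" where
  "subdifferential \<phi> x0 =
     {f \<in> algebraic_dual. \<forall>x. \<phi> x \<ge> \<phi> x0 + ereal (f (x - x0))}"

end

(* Let f be a subgradient of the sum at x0 and c the value of the sum at x0. The set of all
   (x - y, \<alpha> + \<beta> - c - f (y - x0)) with (x, \<alpha>) in epi \<phi>1 and (y, \<beta>) in epi \<phi>2 is convex, has only
   nonnegative heights over 0, and reaches every direction because the epigraphs have a common
   core point. Hahn-Banach gives a linear g below all its heights; taking y = x0 shows that g is a
   subgradient of \<phi>1, taking x = x0 shows that f - g is one of \<phi>2. *)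
theory Submission
  imports Defs
begin

section \<open>Sublinear functionals and the Hahn-Banach theorem\<close>

definition sublinear :: "('a::real_vector \<Rightarrow> real) \<Rightarrow> bool" where
  "sublinear q \<longleftrightarrow> (\<forall>x y. q (x + y) \<le> q x + q y) \<and> (\<forall>t x. 0 < t \<longrightarrow> q (t *\<^sub>R x) \<le> t * q x)"

lemma sublinear_add: "sublinear q \<Longrightarrow> q (x + y) \<le> q x + q y"
  by (simp add: sublinear_def)

lemma sublinear_zero:
  assumes "sublinear q"
  shows "q 0 = 0"
proof -
  \<comment> \<open>The factor 1/2 forces \<open>q 0 \<le> 0\<close> and the factor 2 forces
    \<open>0 \<le> q 0\<close>.\<close>
  have "q ((1/2) *\<^sub>R 0) \<le> (1/2) * q 0" "q (2 *\<^sub>R 0) \<le> 2 * q 0"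
    using assms unfolding sublinear_def by (meson half_gt_zero zero_less_one zero_less_numeral)+
  then show ?thesis by simp
qed

text \<open>Rescaling by the inverse of t yields the reverse inequality. Hence
  \<open>sublinear\<close> can ask for an inequality only, which is easier to check for
  infima.\<close>

lemma sublinear_scale:
  assumes "sublinear q" "0 \<le> t"
  shows "q (t *\<^sub>R x) = t * q x"
proof (cases "t = 0")
  case True
  then show ?thesis by (simp add: sublinear_zero[OF assms(1)])
next
  case False
  with assms have t: "0 < t" by simp
  have "q (inverse t *\<^sub>R (t *\<^sub>R x)) \<le> inverse t * q (t *\<^sub>R x)"
    using assms(1) t unfolding sublinear_def by (meson positive_imp_inverse_positive)
  then have "t * q x \<le> q (t *\<^sub>R x)"
    using t by (simp add: field_simps)
  moreover have "q (t *\<^sub>R x) \<le> t * q x"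
    using assms(1) t by (simp add: sublinear_def)
  ultimately show ?thesis by simp
qed

text \<open>A common source of sublinear functionals, applied below to lowering a functional along a
  direction, to infima of chains and to a gauge. Any s in \<open>A (- x)\<close> gives the lower
  bound \<open>- s\<close> of \<open>A x\<close>, because r + s dominates an element of
  \<open>A 0\<close>.\<close>

lemma sublinear_Inf:
  fixes A :: "'a::real_vector \<Rightarrow> real set"
  assumes nonempty: "\<And>x. A x \<noteq> {}"
    and zero: "\<And>r. r \<in> A 0 \<Longrightarrow> 0 \<le> r"
    and add: "\<And>x y r s. r \<in> A x \<Longrightarrow> s \<in> A y \<Longrightarrow> \<exists>u\<in>A (x + y). u \<le> r + s"
    and scale: "\<And>t x r. 0 < t \<Longrightarrow> r \<in> A x \<Longrightarrow> \<exists>u\<in>A (t *\<^sub>R x). u \<le> t * r"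
  shows "(\<forall>x. bdd_below (A x)) \<and> sublinear (\<lambda>x. Inf (A x))"
proof -
  have bdd: "bdd_below (A x)" for x
  proof -
    obtain s where s: "s \<in> A (- x)" using nonempty by blast
    have "- s \<le> r" if "r \<in> A x" for r
      using add[OF that s] zero by fastforce
    then show ?thesis by (rule bdd_belowI)
  qed
  have "Inf (A (x + y)) \<le> Inf (A x) + Inf (A y)" for x y
  proof -
    have "Inf (A (x + y)) \<le> r + s" if rs: "r \<in> A x" "s \<in> A y" for r s
      using add[OF rs] cInf_lower[OF _ bdd] by force
    then have "Inf (A (x + y)) - r \<le> Inf (A y)" if "r \<in> A x" for r
      using that by (intro cInf_greatest nonempty) (metis add.commute diff_le_eq)
    then have "Inf (A (x + y)) - Inf (A y) \<le> Inf (A x)"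
      by (intro cInf_greatest nonempty) (simp add: algebra_simps)
    then show ?thesis by simp
  qed
  moreover have "Inf (A (t *\<^sub>R x)) \<le> t * Inf (A x)" if t: "0 < t" for t x
  proof -
    have "Inf (A (t *\<^sub>R x)) \<le> t * r" if r: "r \<in> A x" for r
      using scale[OF t r] cInf_lower[OF _ bdd] by force
    then have "Inf (A (t *\<^sub>R x)) / t \<le> Inf (A x)"
      using t by (intro cInf_greatest nonempty) (simp add: field_simps)
    then show ?thesis using t by (simp add: field_simps)
  qed
  ultimately show ?thesis using bdd by (simp add: sublinear_def)
qed

text \<open>A sublinear q that is not superadditive can still be lowered along some y. A minimal q
  is therefore additive, and additivity carries homogeneity over to negative scalars.\<close>

lemma minimal_sublinear_imp_linear:
  fixes q :: "'a::real_vector \<Rightarrow> real"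
  assumes q: "sublinear q"
    and minimal: "\<And>q'. sublinear q' \<Longrightarrow> q' \<le> q \<Longrightarrow> q' = q"
  shows "linear q"
proof -
  have superadditive: "q x + q y \<le> q (x + y)" for x y
  proof -
    (* The infimum of A is a sublinear minorant of q that is linear along y, so it equals q. *)
    define A where "A x = (\<lambda>t. q (x + t *\<^sub>R y) - t * q y) ` {0..}" for x
    have A: "(\<forall>x. bdd_below (A x)) \<and> sublinear (\<lambda>x. Inf (A x))"
    proof (rule sublinear_Inf)
      show "A x \<noteq> {}" for x by (simp add: A_def)
      show "0 \<le> r" if "r \<in> A 0" for r
        using that sublinear_scale[OF q] by (auto simp: A_def)
      show "\<exists>u\<in>A (x + x'). u \<le> r + s" if "r \<in> A x" "s \<in> A x'" for x x' r s
      proof -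
        from that obtain t t' where t: "0 \<le> t" "r = q (x + t *\<^sub>R y) - t * q y"
          and t': "0 \<le> t'" "s = q (x' + t' *\<^sub>R y) - t' * q y"
          by (auto simp: A_def)
        have "q ((x + x') + (t + t') *\<^sub>R y) - (t + t') * q y \<le> r + s"
          using sublinear_add[OF q, of "x + t *\<^sub>R y" "x' + t' *\<^sub>R y"] t t'
          by (simp add: algebra_simps)
        moreover have "q ((x + x') + (t + t') *\<^sub>R y) - (t + t') * q y \<in> A (x + x')"
          unfolding A_def using t t' by (intro imageI) simp
        ultimately show ?thesis by blast
      qed
      show "\<exists>u\<in>A (c *\<^sub>R x). u \<le> c * r" if c: "0 < c" and "r \<in> A x" for c x r
      proof -
        from that obtain t where t: "0 \<le> t" "r = q (x + t *\<^sub>R y) - t * q y"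
          by (auto simp: A_def)
        have "q (c *\<^sub>R x + (c * t) *\<^sub>R y) - (c * t) * q y = c * r"
          using sublinear_scale[OF q, of c "x + t *\<^sub>R y"] c by (simp add: t(2) algebra_simps)
        moreover have "q (c *\<^sub>R x + (c * t) *\<^sub>R y) - (c * t) * q y \<in> A (c *\<^sub>R x)"
          unfolding A_def using t c by (intro imageI) simp
        ultimately show ?thesis by (metis order_refl)
      qed
    qed
    \<comment> \<open>The choice t = 0 puts the infimum below q. Once the infimum is known to equal
      q, t = 1 is superadditivity.\<close>
    have lower: "Inf (A x) \<le> q (x + t *\<^sub>R y) - t * q y" if "0 \<le> t" for x t
      by (rule cInf_lower) (use A that in \<open>auto simp: A_def\<close>)
    have "(\<lambda>x. Inf (A x)) \<le> q"
      using lower[of 0] by (simp add: le_fun_def)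
    then have "(\<lambda>x. Inf (A x)) = q"
      using minimal A by blast
    then show ?thesis
      using lower[of 1 x] by (auto simp: fun_eq_iff)
  qed
  have add: "q (x + y) = q x + q y" for x y
    using superadditive sublinear_add[OF q] by (simp add: order_antisym)
  have neg: "q (- x) = - q x" for x
    using add[of x "- x"] sublinear_zero[OF q] by simp
  have "q (t *\<^sub>R x) = t * q x" for t x
  proof (cases "0 \<le> t")
    case True
    then show ?thesis by (rule sublinear_scale[OF q])
  next
    case False
    then show ?thesis
      using sublinear_scale[OF q, of "- t" x] neg[of "t *\<^sub>R x"] by simp
  qed
  then show ?thesis
    using add by (intro linearI) auto
qed

text \<open>Instead of extending functionals from subspaces, Zorn's lemma is applied to the
  sublinear functionals below p; a minimal one is linear.\<close>

theorem Hahn_Banach_sublinear: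
  fixes p :: "'a::real_vector \<Rightarrow> real"
  assumes p: "sublinear p"
  obtains g where "linear g" "g \<le> p"
proof -
  define S where "S = {q. sublinear q \<and> q \<le> p}"
  have "\<exists>m\<in>S. \<forall>a\<in>S. a \<le> m \<longrightarrow> a = m"
  \<comment> \<open>The order is reversed, so that a maximal element is a minimal functional and an
    upper bound of a chain is its pointwise infimum.\<close>
  proof (rule predicate_Zorn[where P = "\<lambda>a b. b \<le> a"])
    show "partial_order_on S (relation_of (\<lambda>a b. b \<le> a) S)"
      by (rule partial_order_on_relation_ofI) auto
    fix C assume C: "C \<in> Chains (relation_of (\<lambda>a b. b \<le> a) S)"
    then have CS: "C \<subseteq> S"
      by (auto simp: Chains_def relation_of_def)
    have chain: "a \<le> b \<or> b \<le> a" if "a \<in> C" "b \<in> C" for a b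
      using C that by (auto simp: Chains_def relation_of_def)
    show "\<exists>u\<in>S. \<forall>a\<in>C. u \<le> a"
    proof (cases "C = {}")
      case True
      then show ?thesis using p by (auto simp: S_def)
    next
      case False
      define A where "A x = (\<lambda>q. q x) ` C" for x
      have sub: "sublinear q" if "q \<in> C" for q
        using that CS by (auto simp: S_def)
      have A: "(\<forall>x. bdd_below (A x)) \<and> sublinear (\<lambda>x. Inf (A x))"
      proof (rule sublinear_Inf)
        show "A x \<noteq> {}" for x using False by (simp add: A_def)
        show "0 \<le> r" if "r \<in> A 0" for r
          using that by (auto simp: A_def sublinear_zero sub)
        show "\<exists>u\<in>A (x + y). u \<le> r + s" if "r \<in> A x" "s \<in> A y" for x y r s
        proof -
          from that obtain a b where ab: "a \<in> C" "b \<in> C" "r = a x" "s = b y"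
            by (auto simp: A_def)
          \<comment> \<open>The smaller of a and b serves for both arguments at once; this is where
            comparability in the chain enters.\<close>
          then obtain d where d: "d \<in> C" "d \<le> a" "d \<le> b"
            using chain by blast
          then have "d (x + y) \<le> r + s"
            using sublinear_add[OF sub[OF d(1)], of x y] ab
            by (meson add_mono le_funD order_trans)
          then show ?thesis using d(1) by (auto simp: A_def)
        qed
        show "\<exists>u\<in>A (t *\<^sub>R x). u \<le> t * r" if "0 < t" "r \<in> A x" for t x r
          using that sub by (fastforce simp: A_def sublinear_def)
      qed
      have lower: "(\<lambda>x. Inf (A x)) \<le> a" if "a \<in> C" for a
        unfolding le_fun_def by (intro allI cInf_lower) (use A that in \<open>auto simp: A_def\<close>)
      moreover obtain a where "a \<in> C" using False by blast
      ultimately have "(\<lambda>x. Inf (A x)) \<le> p"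
        using CS unfolding S_def by (blast intro: order_trans)
      then show ?thesis
        using A lower by (intro bexI[of _ "\<lambda>x. Inf (A x)"]) (auto simp: S_def)
    qed
  qed
  then obtain m where m: "sublinear m" "m \<le> p"
    and minimal: "\<And>a. sublinear a \<Longrightarrow> a \<le> p \<Longrightarrow> a \<le> m \<Longrightarrow> a = m"
    by (auto simp: S_def)
  have "linear m"
    using m minimal by (intro minimal_sublinear_imp_linear) (auto intro: order_trans)
  with m that show ?thesis by blast
qed

text \<open>The infimum of the slopes r / t over points \<open>(t *\<^sub>R v, r)\<close> of E plays
  the role of a Minkowski gauge. Convexity makes it subadditive, and t = 1 shows that it lies below
  the heights of E.\<close>

lemma convex_linear_minorant:
  fixes E :: "('a::real_vector \<times> real) set"
  assumes convex: "convex E"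
    and absorbing: "\<And>v. \<exists>t>0. \<exists>r. (t *\<^sub>R v, r) \<in> E"
    and zero: "\<And>r. (0, r) \<in> E \<Longrightarrow> 0 \<le> r"
  obtains g where "linear g" "\<And>v r. (v, r) \<in> E \<Longrightarrow> g v \<le> r"
proof -
  define A where "A v = {r / t | r t. 0 < t \<and> (t *\<^sub>R v, r) \<in> E}" for v
  have A: "(\<forall>v. bdd_below (A v)) \<and> sublinear (\<lambda>v. Inf (A v))"
  proof (rule sublinear_Inf)
    show "A v \<noteq> {}" for v using absorbing[of v] by (auto simp: A_def)
    show "0 \<le> r" if "r \<in> A 0" for r
      using that zero by (auto simp: A_def)
    show "\<exists>u\<in>A (x + y). u \<le> a + b" if "a \<in> A x" "b \<in> A y" for x y a b
    proof -
      from that obtain r t s w where rt: "0 < t" "(t *\<^sub>R x, r) \<in> E" "a = r / t"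
        and sw: "0 < w" "(w *\<^sub>R y, s) \<in> E" "b = s / w"
        by (auto simp: A_def)
      \<comment> \<open>These convex weights give x and y the same coefficient t * w / (t + w), so
        the combination lies over a positive multiple of x + y.\<close>
      let ?l = "w / (t + w)" and ?m = "t / (t + w)"
      have "?l *\<^sub>R (t *\<^sub>R x, r) + ?m *\<^sub>R (w *\<^sub>R y, s) \<in> E"
        using rt sw by (intro convexD[OF convex]) (auto simp: add.commute simp flip: add_divide_distrib)
      moreover have "?l *\<^sub>R (t *\<^sub>R x, r) + ?m *\<^sub>R (w *\<^sub>R y, s)
          = ((t * w / (t + w)) *\<^sub>R (x + y), (w * r + t * s) / (t + w))"
        by (simp add: algebra_simps add_divide_distrib)
      ultimately have "((t * w / (t + w)) *\<^sub>R (x + y), (w * r + t * s) / (t + w)) \<in> E"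
        by simp
      moreover have "0 < t * w / (t + w)" using rt sw by simp
      moreover have "(w * r + t * s) / (t + w) / (t * w / (t + w)) = a + b"
      proof -
        have "(w * r + t * s) / (t + w) / (t * w / (t + w)) = (w * r + t * s) / (t * w)"
          using rt(1) sw(1) by simp
        then show ?thesis using rt(1) sw(1) by (simp add: rt(3) sw(3) field_simps)
      qed
      ultimately have "a + b \<in> A (x + y)"
        unfolding A_def by (metis (mono_tags, lifting) mem_Collect_eq)
      then show ?thesis by blast
    qed
    show "\<exists>u\<in>A (c *\<^sub>R x). u \<le> c * a" if c: "0 < c" and "a \<in> A x" for c x a
    proof -
      from that obtain r t where rt: "0 < t" "(t *\<^sub>R x, r) \<in> E" "a = r / t"
        by (auto simp: A_def)
      have "0 < t / c" "((t / c) *\<^sub>R c *\<^sub>R x, r) \<in> E" "c * a = r / (t / c)"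
        using rt c by auto
      then have "c * a \<in> A (c *\<^sub>R x)"
        unfolding A_def by blast
      then show ?thesis by blast
    qed
  qed
  then obtain g where g: "linear g" "g \<le> (\<lambda>v. Inf (A v))"
    using Hahn_Banach_sublinear by blast
  have "g v \<le> r" if "(v, r) \<in> E" for v r
  proof -
    have "r / 1 \<in> A v"
      using that unfolding A_def by (metis (mono_tags, lifting) mem_Collect_eq scaleR_one zero_less_one)
    then have "Inf (A v) \<le> r"
      using A by (simp add: cInf_lower)
    then show ?thesis
      using g(2) by (meson le_funD order_trans)
  qed
  with g(1) that show ?thesis by blast
qed

section \<open>Epigraphs and subgradients\<close>

lemma convex_epi:
  assumes "convex_fun \<phi>" "never_minus_infinity \<phi>"
  shows "convex (epi \<phi>)"
proof (rule convexI)
  fix p q :: "'a \<times> real" and u v :: real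
  assume p: "p \<in> epi \<phi>" and q: "q \<in> epi \<phi>" and uv: "0 \<le> u" "0 \<le> v" "u + v = 1"
  show "u *\<^sub>R p + v *\<^sub>R q \<in> epi \<phi>"
  \<comment> \<open>\<open>convex_fun\<close> speaks only of weights strictly between 0 and 1, so
    the end points are treated apart.\<close>
  proof (cases "u = 0 \<or> v = 0")
    case True
    then show ?thesis using p q uv by auto
  next
    case False
    obtain x \<alpha> y \<beta> where xy: "p = (x, \<alpha>)" "q = (y, \<beta>)"
      by (metis surj_pair)
    have u: "0 < u" "u < 1" "v = 1 - u" using False uv by auto
    have "\<phi> (u *\<^sub>R x + v *\<^sub>R y) \<le> ereal u * \<phi> x + ereal v * \<phi> y"
      using assms(1) u by (simp add: convex_fun_def)
    also have "\<dots> \<le> ereal u * ereal \<alpha> + ereal v * ereal \<beta>"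
      using p q xy uv by (intro add_mono ereal_mult_left_mono) (auto simp: epi_def)
    finally show ?thesis by (simp add: xy epi_def)
  qed
qed

text \<open>Trades extended real inequalities for real ones: a point where \<phi> is infinite has
  nothing above it in the epigraph and imposes no condition.\<close>

lemma subdifferential_iff_epi:
  assumes "\<phi> x0 = ereal c"
  shows "f \<in> subdifferential \<phi> x0 \<longleftrightarrow>
    linear f \<and> (\<forall>x \<alpha>. (x, \<alpha>) \<in> epi \<phi> \<longrightarrow> c + f (x - x0) \<le> \<alpha>)"
proof -
  have "\<phi> x0 + ereal (f (x - x0)) \<le> \<phi> x \<longleftrightarrow> (\<forall>\<alpha>. \<phi> x \<le> ereal \<alpha> \<longrightarrow> c + f (x - x0) \<le> \<alpha>)" for x
    using assms by (cases "\<phi> x") (auto, metis linorder_not_le lt_ex)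
  then show ?thesis
    by (simp add: subdifferential_def algebraic_dual_def epi_def)
qed

lemma eff_dom_obtains_real:
  assumes "never_minus_infinity \<phi>" "x \<in> eff_dom \<phi>"
  obtains c where "\<phi> x = ereal c"
  using assms by (cases "\<phi> x") (auto simp: never_minus_infinity_def eff_dom_def)

section \<open>The two inclusions of the sum rule\<close>

lemma subdifferential_add_subset:
  assumes "never_minus_infinity \<phi>1" "never_minus_infinity \<phi>2"
    and "x0 \<in> eff_dom \<phi>1" "x0 \<in> eff_dom \<phi>2"
  shows "subdifferential \<phi>1 x0 + subdifferential \<phi>2 x0 \<subseteq> subdifferential (\<phi>1 + \<phi>2) x0"
proof
  fix f assume "f \<in> subdifferential \<phi>1 x0 + subdifferential \<phi>2 x0"
  then obtain g h where f: "f = g + h"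
    and g: "g \<in> subdifferential \<phi>1 x0" and h: "h \<in> subdifferential \<phi>2 x0"
    by (auto simp: set_plus_def)
  obtain c d where c: "\<phi>1 x0 = ereal c" and d: "\<phi>2 x0 = ereal d"
    using assms by (meson eff_dom_obtains_real)
  have "linear f"
    using g h by (auto simp: f subdifferential_def algebraic_dual_def plus_fun_def intro: linear_compose_add)
  moreover have "(\<phi>1 + \<phi>2) x0 + ereal (f (x - x0)) \<le> (\<phi>1 + \<phi>2) x" for x
  proof -
    have "ereal (c + g (x - x0)) + ereal (d + h (x - x0)) \<le> \<phi>1 x + \<phi>2 x"
      using g h c d by (intro add_mono) (auto simp: subdifferential_def)
    then show ?thesis by (simp add: f c d algebra_simps)
  qed
  ultimately show "f \<in> subdifferential (\<phi>1 + \<phi>2) x0"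
    by (simp add: subdifferential_def algebraic_dual_def)
qed

lemma subdifferential_sum_subset:
  fixes \<phi>1 \<phi>2 :: "'a::real_vector \<Rightarrow> ereal"
  assumes "never_minus_infinity \<phi>1" "never_minus_infinity \<phi>2"
    and "convex_fun \<phi>1" "convex_fun \<phi>2"
    and core: "core (epi \<phi>1) \<inter> core (epi \<phi>2) \<noteq> {}"
    and "x0 \<in> eff_dom \<phi>1" "x0 \<in> eff_dom \<phi>2"
  shows "subdifferential (\<phi>1 + \<phi>2) x0 \<subseteq> subdifferential \<phi>1 x0 + subdifferential \<phi>2 x0"
proof
  fix f assume f: "f \<in> subdifferential (\<phi>1 + \<phi>2) x0"
  obtain c d where c: "\<phi>1 x0 = ereal c" and d: "\<phi>2 x0 = ereal d"
    using assms by (meson eff_dom_obtains_real)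
  then have cd: "(\<phi>1 + \<phi>2) x0 = ereal (c + d)" by simp
  have lin: "linear f"
    and below: "\<And>x \<alpha>. (x, \<alpha>) \<in> epi (\<phi>1 + \<phi>2) \<Longrightarrow> c + d + f (x - x0) \<le> \<alpha>"
    using f unfolding subdifferential_iff_epi[where \<phi> = "\<phi>1 + \<phi>2" and c = "c + d", OF cd] by auto
  \<comment> \<open>Since f is linear, so is L. The constants go into a translation, which makes E a
    translated linear image of a product of convex sets.\<close>
  define L where "L = (\<lambda>((x, \<alpha>), (y, \<beta>)). (x - y, \<alpha> + \<beta> - f y) :: 'a \<times> real)"
  define E where "E = (\<lambda>z. (0, f x0 - c - d) + z) ` L ` (epi \<phi>1 \<times> epi \<phi>2)"
  have E: "(x - y, \<alpha> + \<beta> - c - d - f (y - x0)) \<in> E" if "(x, \<alpha>) \<in> epi \<phi>1" "(y, \<beta>) \<in> epi \<phi>2"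
    for x y \<alpha> \<beta>
  proof -
    have "(x - y, \<alpha> + \<beta> - c - d - f (y - x0)) = (0, f x0 - c - d) + L ((x, \<alpha>), (y, \<beta>))"
      by (simp add: L_def linear_diff[OF lin])
    then show ?thesis using that unfolding E_def by blast
  qed
  have "linear L"
    by (rule linearI) (auto simp: L_def linear_add[OF lin] linear_scale[OF lin] algebra_simps)
  then have "convex E"
    unfolding E_def using assms
    by (intro convex_translation convex_linear_image convex_Times convex_epi)
  moreover have "\<exists>t>0. \<exists>r. (t *\<^sub>R v, r) \<in> E" for v
  proof -
    from core obtain x \<alpha> where x: "(x, \<alpha>) \<in> core (epi \<phi>1)" "(x, \<alpha>) \<in> core (epi \<phi>2)"
      by auto
    then obtain \<delta> where "0 < \<delta>"
      and "\<And>t. \<bar>t\<bar> < \<delta> \<Longrightarrow> (x, \<alpha>) + t *\<^sub>R (v, 0) \<in> epi \<phi>1"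
      unfolding core_def by blast
    \<comment> \<open>Only the first point moves, by \<delta> / 2 in the direction (v, 0), while the
      second stays at (x, \<alpha>); their difference is a positive multiple of v.\<close>
    from this(1) this(2)[of "\<delta> / 2"] have "0 < \<delta> / 2" "(x + (\<delta> / 2) *\<^sub>R v, \<alpha>) \<in> epi \<phi>1"
      by auto
    moreover have "(x, \<alpha>) \<in> epi \<phi>2"
      using x(2) by (simp add: core_def)
    ultimately show ?thesis
      using E[of "x + (\<delta> / 2) *\<^sub>R v" \<alpha> x \<alpha>] by (metis add_diff_cancel_left')
  qed
  \<comment> \<open>Over 0 both base points coincide, so \<alpha> + \<beta> is a height of the
    epigraph of the sum and the subgradient inequality for f applies.\<close>
  moreover have "0 \<le> r" if "(0, r) \<in> E" for r
  proof -
    from that obtain x \<alpha> \<beta> where "(x, \<alpha>) \<in> epi \<phi>1" "(x, \<beta>) \<in> epi \<phi>2"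
      and r: "r = \<alpha> + \<beta> - c - d - f (x - x0)"
      by (auto simp: E_def L_def linear_diff[OF lin])
    then have "\<phi>1 x + \<phi>2 x \<le> ereal \<alpha> + ereal \<beta>"
      by (intro add_mono) (auto simp: epi_def)
    then have "(x, \<alpha> + \<beta>) \<in> epi (\<phi>1 + \<phi>2)"
      by (simp add: epi_def)
    from below[OF this] r show ?thesis by simp
  qed
  ultimately obtain g where g: "linear g" "\<And>v r. (v, r) \<in> E \<Longrightarrow> g v \<le> r"
    using convex_linear_minorant by blast
  \<comment> \<open>The second point is (x0, d), which leaves the height \<alpha> - c over x -
    x0.\<close>
  have "c + g (x - x0) \<le> \<alpha>" if "(x, \<alpha>) \<in> epi \<phi>1" for x \<alpha>
    using g(2)[OF E[OF that, of x0 d]] d linear_0[OF lin] by (simp add: epi_def)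
  then have "g \<in> subdifferential \<phi>1 x0"
    using g(1) by (simp add: subdifferential_iff_epi[where \<phi> = \<phi>1, OF c])
  \<comment> \<open>The first point is (x0, c); the bound on g (x0 - y) changes sign by
    linearity.\<close>
  moreover have "d + (f - g) (y - x0) \<le> \<beta>" if "(y, \<beta>) \<in> epi \<phi>2" for y \<beta>
    using g(2)[OF E[OF _ that, of x0 c]] c linear_diff[OF g(1)] by (simp add: epi_def)
  then have "f - g \<in> subdifferential \<phi>2 x0"
    using linear_compose_sub[OF lin g(1)]
    by (simp add: subdifferential_iff_epi[where \<phi> = \<phi>2, OF d] fun_diff_def)
  ultimately have "g + (f - g) \<in> subdifferential \<phi>1 x0 + subdifferential \<phi>2 x0"
    by (rule set_plus_intro)
  then show "f \<in> subdifferential \<phi>1 x0 + subdifferential \<phi>2 x0"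
    by simp
qed

(* The sum of functions is pointwise (Function_Algebras) and the sum of sets of
   functionals is the Minkowski sum (Set_Algebras). *)
theorem theorem6p2:
  fixes \<phi>1 \<phi>2 :: "'a::real_vector \<Rightarrow> ereal"
  assumes "never_minus_infinity \<phi>1" and "never_minus_infinity \<phi>2"
    and "proper \<phi>1" and "proper \<phi>2"
    and "convex_fun \<phi>1" and "convex_fun \<phi>2"
    and "core (epi \<phi>1) \<inter> core (epi \<phi>2) \<noteq> {}"
  shows "\<forall>x0 \<in> eff_dom \<phi>1 \<inter> eff_dom \<phi>2.
           subdifferential (\<phi>1 + \<phi>2) x0 = subdifferential \<phi>1 x0 + subdifferential \<phi>2 x0"
  using assms subdifferential_add_subset[of \<phi>1 \<phi>2] subdifferential_sum_subset[of \<phi>1 \<phi>2]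
  by (intro ballI subset_antisym) auto

end
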